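(* Let $M\in\mathbb{R}^{3\times 3}$ be a singular irreducible $F_0$-matrix. Then the Moore-Penrose inverse satisfies $M^{\dagger}\le 0$.
   Context: Inequalities between matrices are entrywise. A real square matrix is a $Z$-matrix if all its off-diagonal entries are nonpositive; any $Z$-matrix can be written as $A=sI-B$ with $s\in\mathbb{R}$ and $B\ge 0$. Let $\rho$ denote the spectral radius, and for $B\in\mathbb{R}^{m\times m}$ let $\rho_{m-1}(B)$ be the maximum of the spectral radii of the principal submatrices of $B$ of order $m-1$. A $Z$-matrix $A=sI-B$ ($B\ge0$) of order $m$ is an $M$-matrix if $s\ge\rho(B)$, and an $N_0$-matrix if $\rho_{m-1}(B)\le s<\rho(B)$. A $Z$-matrix of order $m\ge 3$ is an $F_0$-matrix if all its principal submatrices of orders at most $m-2$ are $M$-matrices and at least one principal submatrix of order $m-1$ is an $N_0$-matrix. The Moore-Penrose inverse $M^{\dagger}$ of a real matrix $M$ is the unique matrix $X$ with $MXM=M$, $XMX=X$, $(MX)^T=MX$, $(XM)^T=XM$. *)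

theory Defs
  imports
    "Jordan_Normal_Form.Spectral_Radius"
    "Jordan_Normal_Form.DL_Submatrix"
    "HOL-Combinatorics.Permutations"
begin

text \<open>
  The order on matrices from \<^theory>\<open>Jordan_Normal_Form.Matrix\<close> is entrywise and includes equality
  of dimensions.
\<close>

definition Z_matrix :: "real mat \<Rightarrow> bool" where
  "Z_matrix A \<longleftrightarrow> square_mat A \<and>
     (\<forall>i < dim_row A. \<forall>j < dim_col A. i \<noteq> j \<longrightarrow> A $$ (i, j) \<le> 0)"

definition principal_submatrices :: "nat \<Rightarrow> 'a mat \<Rightarrow> 'a mat set" where
  "principal_submatrices k A = {submatrix A I I | I. I \<subseteq> {..<dim_row A} \<and> card I = k}"

text \<open>The spectrum is the complex one, so real matrices are first mapped into the complex matrices.\<close>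

definition rho :: "real mat \<Rightarrow> real" where
  "rho B = spectral_radius (map_mat complex_of_real B)"

definition rho_sub :: "nat \<Rightarrow> real mat \<Rightarrow> real" where
  "rho_sub k B = Max (rho ` principal_submatrices k B)"

text \<open>
  The conditions below do not depend on which representation \<open>A = s I - B\<close> with \<open>B \<ge> 0\<close> is chosen:
  replacing \<open>s\<close> by \<open>s + t\<close> replaces \<open>B\<close> by \<open>B + t I\<close>, which, as long as both are nonnegative, shifts
  all the spectral radii involved by \<open>t\<close>.
\<close>

definition Z_splitting :: "real mat \<Rightarrow> real \<Rightarrow> real mat \<Rightarrow> bool" where
  "Z_splitting A s B \<longleftrightarrow>
     B \<in> carrier_mat (dim_row A) (dim_row A) \<and>
     0\<^sub>m (dim_row A) (dim_row A) \<le> B \<and>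
     A = s \<cdot>\<^sub>m 1\<^sub>m (dim_row A) - B"

definition M_matrix :: "real mat \<Rightarrow> bool" where
  "M_matrix A \<longleftrightarrow> Z_matrix A \<and> (\<exists>s B. Z_splitting A s B \<and> rho B \<le> s)"

text \<open>
  For a matrix of order 1 the number \<open>rho_sub 0 B\<close> refers to the empty spectrum and is unspecified;
  \<open>F0_matrix\<close> uses \<open>N0_matrix\<close> only for orders at least 2.
\<close>

definition N0_matrix :: "real mat \<Rightarrow> bool" where
  "N0_matrix A \<longleftrightarrow> Z_matrix A \<and>
     (\<exists>s B. Z_splitting A s B \<and> rho_sub (dim_row A - 1) B \<le> s \<and> s < rho B)"

definition F0_matrix :: "real mat \<Rightarrow> bool" where
  "F0_matrix A \<longleftrightarrow> Z_matrix A \<and> 3 \<le> dim_row A \<and>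
     (\<forall>k \<in> {1..dim_row A - 2}. \<forall>C \<in> principal_submatrices k A. M_matrix C) \<and>
     (\<exists>C \<in> principal_submatrices (dim_row A - 1) A. N0_matrix C)"

text \<open>
  Reducible: some simultaneous permutation of rows and columns gives a block upper triangular matrix
  with two nonempty square diagonal blocks.
\<close>

definition reducible_matrix :: "'a :: zero mat \<Rightarrow> bool" where
  "reducible_matrix A \<longleftrightarrow> (let n = dim_row A in
     \<exists>p k B C D. p permutes {..<n} \<and> 0 < k \<and> k < n \<and>
       B \<in> carrier_mat k k \<and> C \<in> carrier_mat k (n - k) \<and> D \<in> carrier_mat (n - k) (n - k) \<and>
       mat n n (\<lambda>(i, j). A $$ (p i, p j)) = four_block_mat B C (0\<^sub>m (n - k) k) D)"

definition irreducible_matrix :: "'a :: zero mat \<Rightarrow> bool" where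
  "irreducible_matrix A \<longleftrightarrow> square_mat A \<and> \<not> reducible_matrix A"

definition is_moore_penrose_inverse :: "real mat \<Rightarrow> real mat \<Rightarrow> bool" where
  "is_moore_penrose_inverse M X \<longleftrightarrow>
     X \<in> carrier_mat (dim_col M) (dim_row M) \<and>
     M * X * M = M \<and> X * M * X = X \<and>
     (M * X)\<^sup>T = M * X \<and> (X * M)\<^sup>T = X * M"

definition moore_penrose_inverse :: "real mat \<Rightarrow> real mat" where
  "moore_penrose_inverse M = (THE X. is_moore_penrose_inverse M X)"

end

theory Submission
  imports Defs
begin

text \<open>
  Let the principal submatrix on the indices \<open>i, j\<close> be an \<open>N\<^sub>0\<close>-matrix and let \<open>k\<close> be the third index.
  The diagonal of \<open>M\<close> is nonnegative and the minor on \<open>i, j\<close> is negative, so every term of \<open>det M\<close>,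
  with the two terms containing \<open>m\<^bsub>kk\<^esub>\<close> and this minor taken together, is nonpositive. As
  \<open>det M = 0\<close>, all of them vanish. With irreducibility this leaves only star-shaped
  matrices: up to the order of the indices
  \<open>M = (a, g\<^sup>T; h, 0)\<close> with \<open>a \<ge> 0\<close> and negative vectors \<open>g, h\<close>. For these
  \<open>(0, h\<^sup>T / |h|\<^sup>2; g / |g|\<^sup>2, - a g h\<^sup>T / (|g|\<^sup>2 |h|\<^sup>2))\<close> is the Moore-Penrose inverse.
\<close>

section \<open>Index triples and determinants of order 2 and 3\<close>

lemma sum_upto_3:
  fixes f :: "nat \<Rightarrow> 'a :: comm_monoid_add"
  assumes "{i, j, k} = {..<3}" and "i \<noteq> j" "i \<noteq> k" "j \<noteq> k"
  shows "sum f {0..<3} = f i + f j + f k"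
proof -
  have "{0..<3} = {i, j, k}" unfolding assms(1) by (rule atLeast0LessThan)
  then show ?thesis using assms(2-4) by (simp add: add.assoc)
qed

lemma triple_cases:
  fixes i j k :: nat
  assumes "{i, j, k} = {..<3}" and "i \<noteq> j" "i \<noteq> k" "j \<noteq> k"
  shows "(i, j, k) \<in> {(0,1,2), (0,2,1), (1,0,2), (1,2,0), (2,0,1), (2,1,0)}"
proof -
  have "i < 3" "j < 3" "k < 3" using assms(1) by auto
  then have "i \<in> {0,1,2}" "j \<in> {0,1,2}" "k \<in> {0,1,2}" by auto
  then show ?thesis using assms(2-4) by auto
qed

lemma det_2:
  fixes A :: "'a :: comm_ring_1 mat"
  assumes A: "A \<in> carrier_mat 2 2"
  shows "det A = A $$ (0,0) * A $$ (1,1) - A $$ (0,1) * A $$ (1,0)"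
proof -
  have "det A = (\<Sum>j<2. A $$ (0,j) * cofactor A 0 j)"
    by (rule laplace_expansion_row[OF A]) simp
  moreover have "det (mat_delete A 0 j) = mat_delete A 0 j $$ (0,0)" for j
    by (rule det_single) (use A in \<open>auto simp: mat_delete_def\<close>)
  ultimately show ?thesis using A
    by (simp add: numeral_2_eq_2 cofactor_def) (simp add: mat_delete_def)
qed

lemma det_3:
  fixes A :: "'a :: comm_ring_1 mat"
  assumes A: "A \<in> carrier_mat 3 3"
  shows "det A = A $$ (0,0) * (A $$ (1,1) * A $$ (2,2) - A $$ (1,2) * A $$ (2,1))
    - A $$ (0,1) * (A $$ (1,0) * A $$ (2,2) - A $$ (1,2) * A $$ (2,0))
    + A $$ (0,2) * (A $$ (1,0) * A $$ (2,1) - A $$ (1,1) * A $$ (2,0))"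
proof -
  have "det A = (\<Sum>j<3. A $$ (0,j) * cofactor A 0 j)"
    by (rule laplace_expansion_row[OF A]) simp
  moreover have "det (mat_delete A 0 j) = mat_delete A 0 j $$ (0,0) * mat_delete A 0 j $$ (1,1)
      - mat_delete A 0 j $$ (0,1) * mat_delete A 0 j $$ (1,0)" for j
    by (rule det_2) (use A in \<open>auto simp: mat_delete_def\<close>)
  ultimately show ?thesis using A
    by (simp add: eval_nat_numeral cofactor_def) (simp add: mat_delete_def algebra_simps)
qed

text \<open>A simultaneous permutation of rows and columns does not change the determinant; the six
  orderings are checked one by one. This allows the indices to be named after the minor that is an
  \<open>N0_matrix\<close> instead of fixing its position.\<close>

lemma det_3_symmetric:
  fixes A :: "'a :: comm_ring_1 mat"
  assumes A: "A \<in> carrier_mat 3 3"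
    and ijk: "{i, j, k} = {..<3}" "i \<noteq> j" "i \<noteq> k" "j \<noteq> k"
  shows "det A = A $$ (i,i) * (A $$ (j,j) * A $$ (k,k) - A $$ (j,k) * A $$ (k,j))
    - A $$ (i,j) * (A $$ (j,i) * A $$ (k,k) - A $$ (j,k) * A $$ (k,i))
    + A $$ (i,k) * (A $$ (j,i) * A $$ (k,j) - A $$ (j,j) * A $$ (k,i))"
  using triple_cases[OF ijk] unfolding det_3[OF A]
  by (elim insertE emptyE) (simp_all add: algebra_simps)

lemma det_zero_if_not_invertible:
  fixes A :: "'a :: field mat"
  assumes A: "A \<in> carrier_mat n n" and "\<not> invertible_mat A"
  shows "det A = 0"
proof (rule ccontr)
  assume "det A \<noteq> 0"
  from det_non_zero_imp_unit[OF A this] obtain B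
    where "B \<in> carrier_mat n n" "A * B = 1\<^sub>m n" "B * A = 1\<^sub>m n"
    by (auto simp: Units_def ring_mat_def)
  then have "invertible_mat A" using A
    unfolding invertible_mat_def inverts_mat_def by auto
  with assms show False by simp
qed

section \<open>Principal submatrices and the spectral radius\<close>

lemma submatrix_eq_pick:
  assumes "A \<in> carrier_mat n n" and "I \<subseteq> {..<n}"
  shows "submatrix A I I = mat (card I) (card I) (\<lambda>(i, j). A $$ (pick I i, pick I j))"
proof -
  have "{i. i < n \<and> i \<in> I} = I" using assms by auto
  then show ?thesis using assms unfolding submatrix_def by auto
qed

lemma singleton_principal_submatrix:
  assumes A: "A \<in> carrier_mat n n" and i: "i < n"
  shows "mat 1 1 (\<lambda>_. A $$ (i,i)) \<in> principal_submatrices 1 A"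
proof -
  have "pick {i} 0 = i" using pick_in_set[of 0 "{i}"] by simp
  then have "submatrix A {i} {i} = mat 1 1 (\<lambda>_. A $$ (i,i))"
    unfolding submatrix_eq_pick[OF A, of "{i}", simplified, OF i] by auto
  then show ?thesis using A i unfolding principal_submatrices_def
    by (auto intro!: exI[of _ "{i}"])
qed

text \<open>Finiteness makes the \<open>Max\<close> in \<open>rho_sub\<close> an upper bound for the
  spectral radius of each such submatrix.\<close>

lemma finite_principal_submatrices: "finite (principal_submatrices k A)"
proof -
  have "principal_submatrices k A \<subseteq> (\<lambda>I. submatrix A I I) ` Pow {..<dim_row A}"
    unfolding principal_submatrices_def by auto
  then show ?thesis by (rule finite_subset) simp
qed

lemma norm_eigenvalue_le_rho:
  assumes B: "B \<in> carrier_mat n n" and "0 < n"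
    and "eigenvalue (map_mat complex_of_real B) e"
  shows "norm e \<le> rho B"
  using spectral_radius_mem_max(2)[of "map_mat complex_of_real B" n "norm e"] assms
  unfolding rho_def spectrum_def by auto

lemma rho_eigenvalue:
  assumes B: "B \<in> carrier_mat n n" and "0 < n"
  obtains e where "eigenvalue (map_mat complex_of_real B) e" "norm e = rho B"
  using spectral_radius_mem_max(1)[of "map_mat complex_of_real B" n] assms
  unfolding rho_def spectrum_def by auto

text \<open>The only entry is itself an eigenvalue, so its absolute value is bounded by the spectral
  radius.\<close>

lemma entry_le_rho_1:
  assumes B: "B \<in> carrier_mat 1 1"
  shows "B $$ (0,0) \<le> rho B"
proof -
  define e where "e = complex_of_real (B $$ (0,0))"
  have "det (char_matrix (map_mat complex_of_real B) e) = 0"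
    by (subst det_single) (use B in \<open>auto simp: char_matrix_def e_def\<close>)
  then have "eigenvalue (map_mat complex_of_real B) e"
    by (subst eigenvalue_det[of _ 1]) (use B in auto)
  from norm_eigenvalue_le_rho[OF B _ this] show ?thesis unfolding e_def by simp
qed

lemma eigenvalue_2:
  fixes A :: "'a :: field mat"
  assumes A: "A \<in> carrier_mat 2 2" and "eigenvalue A e"
  shows "(A $$ (0,0) - e) * (A $$ (1,1) - e) = A $$ (0,1) * A $$ (1,0)"
proof -
  have "char_matrix A e \<in> carrier_mat 2 2" using A by (auto simp: char_matrix_def)
  from det_2[OF this] eigenvalue_det[OF A, of e] assms(2) show ?thesis using A
    by (simp add: char_matrix_def)
qed

section \<open>Sign conditions from M-matrices of order 1 and N0-matrices of order 2\<close>

lemma M_matrix_order_1: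
  assumes C: "C \<in> carrier_mat 1 1" and "M_matrix C"
  shows "0 \<le> C $$ (0,0)"
proof -
  obtain s B where B: "B \<in> carrier_mat 1 1" and CB: "C = s \<cdot>\<^sub>m 1\<^sub>m 1 - B" and "rho B \<le> s"
    using assms unfolding M_matrix_def Z_splitting_def by auto
  from entry_le_rho_1[OF B] this(3) have "B $$ (0,0) \<le> s" by simp
  then show ?thesis unfolding CB using B by simp
qed

text \<open>For \<open>C = s I - B\<close> the claim compares the product of the
  \<open>s - B $$ (i,i)\<close> with \<open>B $$ (0,1) * B $$ (1,0)\<close>. An eigenvalue of
  maximal modulus turns the latter into a product of two distances from that eigenvalue to the
  diagonal entries, and these distances are larger because its modulus exceeds
  \<open>s\<close>.\<close>

lemma N0_matrix_order_2:
  assumes C: "C \<in> carrier_mat 2 2" and "N0_matrix C"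
  shows "C $$ (0,0) * C $$ (1,1) < C $$ (0,1) * C $$ (1,0)"
proof (rule ccontr)
  assume contr: "\<not> ?thesis"
  obtain s B where B: "B \<in> carrier_mat 2 2" and B0: "0\<^sub>m 2 2 \<le> B"
    and CB: "C = s \<cdot>\<^sub>m 1\<^sub>m 2 - B" and s1: "rho_sub 1 B \<le> s" and s: "s < rho B"
    using assms unfolding N0_matrix_def Z_splitting_def by auto
  have nonneg: "0 \<le> B $$ (i,j)" if "i < 2" "j < 2" for i j
    using B0 B that unfolding less_eq_mat_def by auto
  \<comment> \<open>The principal submatrices of order 1 are the diagonal entries, so the lower
    bound on \<open>s\<close> applies to them.\<close>
  have diag: "B $$ (i,i) \<le> s" if "i < 2" for i
  proof -
    let ?S = "mat 1 1 (\<lambda>_. B $$ (i,i))"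
    have "B $$ (i,i) \<le> rho ?S" using entry_le_rho_1[of ?S] by simp
    also have "\<dots> \<le> rho_sub 1 B" unfolding rho_sub_def
      by (intro Max_ge finite_imageI finite_principal_submatrices imageI
          singleton_principal_submatrix[OF B that])
    finally show ?thesis using s1 by simp
  qed
  obtain e where e: "eigenvalue (map_mat complex_of_real B) e" "norm e = rho B"
    using rho_eigenvalue[OF B] by auto
  \<comment> \<open>\<open>e\<close> is a zero of the characteristic polynomial, but it lies too far from both diagonal entries.\<close>
  have far: "s - B $$ (i,i) < norm (complex_of_real (B $$ (i,i)) - e)" if "i < 2" for i
    using norm_triangle_ineq2[of e "complex_of_real (B $$ (i,i))"] nonneg[OF that that] e(2) s
    by (simp add: norm_minus_commute)
  have "(complex_of_real (B $$ (0,0)) - e) * (complex_of_real (B $$ (1,1)) - e)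
      = complex_of_real (B $$ (0,1) * B $$ (1,0))"
    using eigenvalue_2[OF _ e(1)] B by simp
  \<comment> \<open>Moduli are taken because \<open>e\<close> may be non-real; the right-hand side
    is nonnegative and hence its own modulus.\<close>
  then have "norm (complex_of_real (B $$ (0,0)) - e) * norm (complex_of_real (B $$ (1,1)) - e)
      = B $$ (0,1) * B $$ (1,0)"
    using nonneg[of 0 1] nonneg[of 1 0]
    by (metis abs_of_nonneg norm_mult norm_of_real one_less_numeral_iff pos2 semiring_norm(76)
        zero_le_mult_iff)
  moreover have "(s - B $$ (0,0)) * (s - B $$ (1,1))
      < norm (complex_of_real (B $$ (0,0)) - e) * norm (complex_of_real (B $$ (1,1)) - e)"
    using far[of 0] far[of 1] diag[of 0] diag[of 1] by (intro mult_strict_mono') auto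
  ultimately show False using contr unfolding CB using B by simp
qed

section \<open>Irreducibility in order 3\<close>

text \<open>Otherwise swapping \<open>i\<close> with the last index produces a last row that
  vanishes left of the diagonal, which is a zero block of size 1 by 2.\<close>

lemma row_not_zero_if_irreducible:
  fixes A :: "'a :: zero mat"
  assumes A: "A \<in> carrier_mat 3 3" and irr: "irreducible_matrix A"
    and ijk: "{i, j, k} = {..<3}" "i \<noteq> j" "i \<noteq> k" "j \<noteq> k"
  shows "A $$ (i,j) \<noteq> 0 \<or> A $$ (i,k) \<noteq> 0"
proof (rule ccontr)
  assume "\<not> ?thesis"
  then have z: "A $$ (i,j) = 0" "A $$ (i,k) = 0" by auto
  have i3: "i < 3" using ijk(1) by auto
  define p where "p = transpose i 2"
  have p: "p permutes {..<3}" unfolding p_def using i3 by (intro permutes_swap_id) auto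
  have row: "A $$ (p 2, p y) = 0" if "y < 2" for y
  proof -
    have "p 2 = i" by (simp add: p_def)
    moreover have "p y \<noteq> p 2" using that inj_eq[OF permutes_inj[OF p], of y 2] by simp
    moreover have "p y \<in> {i, j, k}" unfolding ijk(1) using permutes_in_image[OF p, of y] that by simp
    ultimately show ?thesis using z by auto
  qed
  let ?P = "mat 3 3 (\<lambda>(x, y). A $$ (p x, p y))"
  have "?P = four_block_mat (mat 2 2 (\<lambda>(x, y). A $$ (p x, p y)))
      (mat 2 1 (\<lambda>(x, y). A $$ (p x, p 2))) (0\<^sub>m 1 2) (mat 1 1 (\<lambda>(x, y). A $$ (p 2, p 2)))"
    using row by (intro eq_matI) (auto simp: four_block_mat_def Let_def less_Suc_eq eval_nat_numeral)
  then have "reducible_matrix A" unfolding reducible_matrix_def Let_def using A p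
    by (intro exI[of _ p] exI[of _ 2] exI conjI) auto
  with irr show False unfolding irreducible_matrix_def by simp
qed

text \<open>Otherwise swapping \<open>i\<close> with the first index produces a first column that
  vanishes below the diagonal, which is a zero block of size 2 by 1.\<close>

lemma col_not_zero_if_irreducible:
  fixes A :: "'a :: zero mat"
  assumes A: "A \<in> carrier_mat 3 3" and irr: "irreducible_matrix A"
    and ijk: "{i, j, k} = {..<3}" "i \<noteq> j" "i \<noteq> k" "j \<noteq> k"
  shows "A $$ (j,i) \<noteq> 0 \<or> A $$ (k,i) \<noteq> 0"
proof (rule ccontr)
  assume "\<not> ?thesis"
  then have z: "A $$ (j,i) = 0" "A $$ (k,i) = 0" by auto
  have i3: "i < 3" using ijk(1) by auto
  define p where "p = transpose i 0"
  have p: "p permutes {..<3}" unfolding p_def using i3 by (intro permutes_swap_id) auto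
  have col: "A $$ (p x, p 0) = 0" if "0 < x" "x < 3" for x
  proof -
    have "p 0 = i" by (simp add: p_def)
    moreover have "p x \<noteq> p 0" using that inj_eq[OF permutes_inj[OF p], of x 0] by simp
    moreover have "p x \<in> {i, j, k}" unfolding ijk(1) using permutes_in_image[OF p, of x] that by simp
    ultimately show ?thesis using z by auto
  qed
  let ?P = "mat 3 3 (\<lambda>(x, y). A $$ (p x, p y))"
  have "?P = four_block_mat (mat 1 1 (\<lambda>(x, y). A $$ (p 0, p 0)))
      (mat 1 2 (\<lambda>(x, y). A $$ (p 0, p (Suc y)))) (0\<^sub>m 2 1)
      (mat 2 2 (\<lambda>(x, y). A $$ (p (Suc x), p (Suc y))))"
    using col by (intro eq_matI) (auto simp: four_block_mat_def Let_def)
  then have "reducible_matrix A" unfolding reducible_matrix_def Let_def using A p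
    by (intro exI[of _ p] exI[of _ 1] exI conjI) auto
  with irr show False unfolding irreducible_matrix_def by simp
qed

section \<open>The Moore-Penrose inverse: uniqueness, and its value for star-shaped matrices\<close>

text \<open>Penrose's argument: since \<open>M * X\<close> and \<open>M * Y\<close> are symmetric,
  transposing reverses their product, and the two ways of collapsing it give
  \<open>M * X = M * Y\<close>. Likewise \<open>X * M = Y * M\<close>, and then
  \<open>X = X * M * X\<close> can be rewritten into \<open>Y * M * Y\<close>.\<close>

lemma is_moore_penrose_inverse_unique:
  assumes X: "is_moore_penrose_inverse M X" and Y: "is_moore_penrose_inverse M Y"
  shows "X = Y"
proof -
  define n m where "n = dim_row M" and "m = dim_col M"
  have cM: "M \<in> carrier_mat n m" by (simp add: n_def m_def)
  have cX: "X \<in> carrier_mat m n" and cY: "Y \<in> carrier_mat m n"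
    using X Y by (auto simp: is_moore_penrose_inverse_def n_def m_def)
  note x = X[unfolded is_moore_penrose_inverse_def] and y = Y[unfolded is_moore_penrose_inverse_def]
  have "M * X = (M * Y * M) * X" using y by simp
  also have "\<dots> = (M * Y) * (M * X)"
    by (rule assoc_mult_mat[of _ n n _ m _ n]) (use cM cX cY in auto)
  also have "\<dots> = (M * Y)\<^sup>T * (M * X)\<^sup>T" using x y by simp
  also have "\<dots> = ((M * X) * (M * Y))\<^sup>T"
    by (rule transpose_mult[symmetric, of _ n n _ n]) (use cM cX cY in auto)
  also have "(M * X) * (M * Y) = (M * X * M) * Y"
    by (rule assoc_mult_mat[symmetric, of _ n n _ m _ n]) (use cM cX cY in auto)
  also have "\<dots>\<^sup>T = M * Y" using x y by simp
  finally have 1: "M * X = M * Y" .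
  have "X * M = X * (M * Y * M)" using y by simp
  also have "\<dots> = X * (M * (Y * M))"
    using assoc_mult_mat[OF cM cY cM] by simp
  also have "\<dots> = (X * M) * (Y * M)"
    by (rule assoc_mult_mat[symmetric, of _ m n _ m _ m]) (use cM cX cY in auto)
  also have "\<dots> = (X * M)\<^sup>T * (Y * M)\<^sup>T" using x y by simp
  also have "\<dots> = ((Y * M) * (X * M))\<^sup>T"
    by (rule transpose_mult[symmetric, of _ m m _ m]) (use cM cX cY in auto)
  also have "(Y * M) * (X * M) = Y * (M * (X * M))"
    by (rule assoc_mult_mat[of _ m n _ m _ m]) (use cM cX cY in auto)
  also have "M * (X * M) = M * X * M"
    using assoc_mult_mat[OF cM cX cM] by simp
  also have "(Y * \<dots>)\<^sup>T = Y * M" using x y by simp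
  finally have 2: "X * M = Y * M" .
  have "X = X * M * X" using x by simp
  also have "\<dots> = Y * (M * X)" unfolding 2 by (rule assoc_mult_mat[OF cY cM cX])
  also have "\<dots> = Y * M * Y" unfolding 1 by (rule assoc_mult_mat[OF cY cM cY, symmetric])
  finally show ?thesis using y by simp
qed

lemma moore_penrose_inverse_eqI:
  assumes "is_moore_penrose_inverse M X"
  shows "moore_penrose_inverse M = X"
  unfolding moore_penrose_inverse_def
  using assms is_moore_penrose_inverse_unique by blast

text \<open>Here \<open>i\<close> is the centre of the star and \<open>j\<close>, \<open>k\<close>
  are its leaves. Strict negativity at the leaf \<open>j\<close> makes the row and column vectors
  nonzero, so that the explicit inverse can divide by their squared lengths.\<close>

lemma moore_penrose_star:
  fixes M :: "real mat"
  assumes M: "M \<in> carrier_mat 3 3"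
    and ijk: "{i, j, k} = {..<3}" "i \<noteq> j" "i \<noteq> k" "j \<noteq> k"
    and zero: "M $$ (j,j) = 0" "M $$ (j,k) = 0" "M $$ (k,j) = 0" "M $$ (k,k) = 0"
    and diag: "0 \<le> M $$ (i,i)"
    and row: "M $$ (i,j) < 0" "M $$ (i,k) \<le> 0"
    and col: "M $$ (j,i) < 0" "M $$ (k,i) \<le> 0"
  shows "moore_penrose_inverse M \<le> 0\<^sub>m 3 3"
proof -
  define G where "G = (M $$ (i,j))\<^sup>2 + (M $$ (i,k))\<^sup>2"
  define H where "H = (M $$ (j,i))\<^sup>2 + (M $$ (k,i))\<^sup>2"
  have G: "0 < G" and H: "0 < H" using row col by (auto simp: G_def H_def intro!: add_pos_nonneg)
  \<comment> \<open>These are the leaf parts of row and column \<open>i\<close> divided by their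
    squared lengths, so that pairing each with the original vector gives 1.\<close>
  define g h where "g x = M $$ (i,x) / G" and "h x = M $$ (x,i) / H" for x
  define X where "X = mat 3 3 (\<lambda>(x, y).
    if x = i then (if y = i then 0 else h y)
    else if y = i then g x
    else - (M $$ (i,i) * g x * h y))"
  have X: "X \<in> carrier_mat 3 3" by (simp add: X_def)
  have lt: "i < 3" "j < 3" "k < 3" using ijk(1) by auto
  have cases3: "x = i \<or> x = j \<or> x = k" if "x < 3" for x using that ijk(1) by auto
  have mult: "(A * B) $$ (x, y) = A $$ (x,i) * B $$ (i,y) + A $$ (x,j) * B $$ (j,y) + A $$ (x,k) * B $$ (k,y)"
    if "A \<in> carrier_mat 3 3" "B \<in> carrier_mat 3 3" "x < 3" "y < 3" for A B :: "real mat" and x y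
    using that lt by (simp add: times_mat_def scalar_prod_def sum_upto_3[OF ijk])
  have eqI: "A = B" if "A \<in> carrier_mat 3 3" "B \<in> carrier_mat 3 3"
    "\<And>x y. x \<in> {i, j, k} \<Longrightarrow> y \<in> {i, j, k} \<Longrightarrow> A $$ (x,y) = B $$ (x,y)" for A B :: "real mat"
    using that(1,2) by (intro eq_matI that(3)) (auto simp: ijk(1))
  have Xe: "X $$ (i,i) = 0" "X $$ (i,j) = h j" "X $$ (i,k) = h k"
    "X $$ (j,i) = g j" "X $$ (k,i) = g k"
    "X $$ (j,j) = - (M $$ (i,i) * g j * h j)" "X $$ (j,k) = - (M $$ (i,i) * g j * h k)"
    "X $$ (k,j) = - (M $$ (i,i) * g k * h j)" "X $$ (k,k) = - (M $$ (i,i) * g k * h k)"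
    using lt ijk by (auto simp: X_def)
  have g: "M $$ (i,j) * g j + M $$ (i,k) * g k = 1"
    using G by (simp add: g_def add_divide_distrib[symmetric]) (simp add: G_def power2_eq_square)
  have h: "M $$ (j,i) * h j + M $$ (k,i) * h k = 1"
    using H by (simp add: h_def add_divide_distrib[symmetric]) (simp add: H_def power2_eq_square)
  have gw: "t * M $$ (i,j) * g j + t * M $$ (i,k) * g k = t" for t
    by (metis g mult.assoc distrib_left mult.right_neutral)
  have hw: "t * h j * M $$ (j,i) + t * h k * M $$ (k,i) = t" for t
    by (metis h mult.assoc mult.commute distrib_left mult.right_neutral)
  \<comment> \<open>The leaf block of \<open>X\<close> is chosen for this cancellation: with
    \<open>t\<close> an entry of \<open>h\<close> the left side is an entry of \<open>M * X\<close>
    in row \<open>i\<close> at a leaf. The next fact does the same for column \<open>i\<close> of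
    \<open>X * M\<close>, with \<open>t\<close> an entry of \<open>g\<close>.\<close>
  have gz: "M $$ (i,i) * t + M $$ (i,j) * - (M $$ (i,i) * g j * t)
      + M $$ (i,k) * - (M $$ (i,i) * g k * t) = 0" for t
    using gw[of "M $$ (i,i) * t"] by (simp add: algebra_simps)
  have hz: "t * M $$ (i,i) + - (M $$ (i,i) * t * h j) * M $$ (j,i)
      + - (M $$ (i,i) * t * h k) * M $$ (k,i) = 0" for t
    using hw[of "M $$ (i,i) * t"] by (simp add: algebra_simps)
  \<comment> \<open>With \<open>t\<close> from \<open>g\<close> and \<open>u\<close> from
    \<open>h\<close> these are the leaf entries of \<open>Q * X\<close> for the product
    \<open>Q = X * M\<close> below.\<close>
  have gx: "- (t * M $$ (i,j) * (M $$ (i,i) * g j * u)) - t * M $$ (i,k) * (M $$ (i,i) * g k * u)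
      = - (M $$ (i,i) * t * u)" for t u
    using gw[of "M $$ (i,i) * t * u"] by (simp add: algebra_simps)
  \<comment> \<open>Both products are 1 at the centre and, on the leaves, the orthogonal projector
    onto the line of the column vector (for \<open>P\<close>) or of the row vector (for
    \<open>Q\<close>). Symmetry is then visible, and the other two Penrose equations become
    \<open>P * M = M\<close> and \<open>Q * X = X\<close>.\<close>
  define P Q where "P = M * X" and "Q = X * M"
  have P: "P \<in> carrier_mat 3 3" and Q: "Q \<in> carrier_mat 3 3" using M X by (auto simp: P_def Q_def)
  have Pe: "P $$ (i,i) = 1" "P $$ (i,j) = 0" "P $$ (i,k) = 0" "P $$ (j,i) = 0" "P $$ (k,i) = 0"
    "P $$ (j,j) = M $$ (j,i) * h j" "P $$ (j,k) = M $$ (j,i) * h k"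
    "P $$ (k,j) = M $$ (k,i) * h j" "P $$ (k,k) = M $$ (k,i) * h k"
    unfolding P_def mult[OF M X lt(1) lt(1)] mult[OF M X lt(1) lt(2)] mult[OF M X lt(1) lt(3)]
      mult[OF M X lt(2) lt(1)] mult[OF M X lt(2) lt(2)] mult[OF M X lt(2) lt(3)]
      mult[OF M X lt(3) lt(1)] mult[OF M X lt(3) lt(2)] mult[OF M X lt(3) lt(3)] Xe zero
    using g gz by simp_all
  have Qe: "Q $$ (i,i) = 1" "Q $$ (i,j) = 0" "Q $$ (i,k) = 0" "Q $$ (j,i) = 0" "Q $$ (k,i) = 0"
    "Q $$ (j,j) = g j * M $$ (i,j)" "Q $$ (j,k) = g j * M $$ (i,k)"
    "Q $$ (k,j) = g k * M $$ (i,j)" "Q $$ (k,k) = g k * M $$ (i,k)"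
    unfolding Q_def mult[OF X M lt(1) lt(1)] mult[OF X M lt(1) lt(2)] mult[OF X M lt(1) lt(3)]
      mult[OF X M lt(2) lt(1)] mult[OF X M lt(2) lt(2)] mult[OF X M lt(2) lt(3)]
      mult[OF X M lt(3) lt(1)] mult[OF X M lt(3) lt(2)] mult[OF X M lt(3) lt(3)] Xe zero
    using h hz by (simp_all add: mult.commute)
  have "P * M = M"
  proof (rule eqI)
    fix x y assume "x \<in> {i, j, k}" "y \<in> {i, j, k}"
    then show "(P * M) $$ (x,y) = M $$ (x,y)"
      using lt by (elim insertE emptyE) (simp_all add: mult[OF P M] Pe zero hw)
  qed (use P M in auto)
  moreover have "Q * X = X"
  proof (rule eqI)
    fix x y assume "x \<in> {i, j, k}" "y \<in> {i, j, k}"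
    then show "(Q * X) $$ (x,y) = X $$ (x,y)"
      using lt by (elim insertE emptyE) (simp_all add: mult[OF Q X] Qe Xe gw gx)
  qed (use Q X in auto)
  moreover have "P\<^sup>T = P"
    by (rule eqI) (use P lt in \<open>auto simp: Pe h_def\<close>)
  moreover have "Q\<^sup>T = Q"
    by (rule eqI) (use Q lt in \<open>auto simp: Qe g_def\<close>)
  ultimately have "is_moore_penrose_inverse M X"
    unfolding is_moore_penrose_inverse_def P_def Q_def using M X by auto
  then have "moore_penrose_inverse M = X" by (rule moore_penrose_inverse_eqI)
  moreover have "X $$ (x,y) \<le> 0" if "x < 3" "y < 3" for x y
  proof -
    have "g j \<le> 0" "g k \<le> 0" "h j \<le> 0" "h k \<le> 0"
      using G H row col by (auto simp: g_def h_def divide_nonpos_pos)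
    then show ?thesis using cases3[OF that(1)] cases3[OF that(2)] diag
      by (elim disjE) (simp_all add: Xe mult.assoc mult_nonpos_nonpos mult_nonneg_nonneg)
  qed
  ultimately show ?thesis using X by (auto simp: less_eq_mat_def)
qed

section \<open>Sign analysis of the vanishing determinant, and conclusion\<close>

text \<open>The matrix has rows \<open>(a, p, q)\<close>, \<open>(r, b, u)\<close>,
  \<open>(v, w, c)\<close>, listed in the order \<open>i, j, k\<close>. The two alternatives are
  stars centred at the first and at the second index.\<close>

lemma singular_3_forces_star:
  fixes a b c p q r u v w :: real
  assumes nonneg: "0 \<le> a" "0 \<le> b" "0 \<le> c"
    and nonpos: "p \<le> 0" "q \<le> 0" "r \<le> 0" "u \<le> 0" "v \<le> 0" "w \<le> 0"
    and minor: "a * b < p * r"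
    and det: "a * (b * c - u * w) - p * (r * c - u * v) + q * (r * w - b * v) = 0"
    and row: "v \<noteq> 0 \<or> w \<noteq> 0" and col: "q \<noteq> 0 \<or> u \<noteq> 0"
  shows "p < 0 \<and> r < 0 \<and> c = 0 \<and>
    (b = 0 \<and> u = 0 \<and> w = 0 \<or> a = 0 \<and> q = 0 \<and> v = 0)"
proof -
  have pr: "p < 0" "r < 0"
    using minor mult_nonneg_nonneg[OF nonneg(1,2)] nonpos(1,3) by (auto simp: less_le)
  \<comment> \<open>This is minus the determinant, grouped so that every summand is
    nonnegative.\<close>
  have "(p * r - a * b) * c + a * (u * w) + - (p * (u * v)) + - (r * (q * w)) + b * (q * v) = 0"
    using det by (simp add: algebra_simps)
  moreover have "0 \<le> (p * r - a * b) * c" "0 \<le> a * (u * w)" "0 \<le> - (p * (u * v))"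
    "0 \<le> - (r * (q * w))" "0 \<le> b * (q * v)"
    using nonneg nonpos minor
    by (simp_all add: mult_nonpos_nonneg mult_nonpos_nonpos)
  ultimately have "(p * r - a * b) * c = 0" "a * (u * w) = 0" "p * (u * v) = 0"
    "r * (q * w) = 0" "b * (q * v) = 0"
    by linarith+
  \<comment> \<open>The factors \<open>p\<close>, \<open>r\<close> and \<open>p * r - a * b\<close>
    are nonzero, so \<open>c\<close>, \<open>u * v\<close> and \<open>q * w\<close> vanish. If
    \<open>u\<close> is nonzero, then \<open>v = 0\<close>, hence \<open>w\<close> is nonzero, and
    \<open>q\<close> and \<open>a\<close> vanish. If \<open>u = 0\<close>, then \<open>q\<close> is
    nonzero, so \<open>w = 0\<close>, hence \<open>v\<close> is nonzero, and
    \<open>b = 0\<close>.\<close>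
  then show ?thesis using pr minor row col by auto
qed

theorem theorem4p9:
  fixes M :: "real mat"
  assumes "M \<in> carrier_mat 3 3"
    and "\<not> invertible_mat M"
    and "irreducible_matrix M"
    and "F0_matrix M"
  shows "moore_penrose_inverse M \<le> 0\<^sub>m 3 3"
proof -
  note M = assms(1)
  have Z: "M $$ (x,y) \<le> 0" if "x < 3" "y < 3" "x \<noteq> y" for x y
    using assms that unfolding F0_matrix_def Z_matrix_def by auto
  have diag: "0 \<le> M $$ (x,x)" if "x < 3" for x
  proof -
    \<comment> \<open>In order 3 the bound \<open>dim_row M - 2\<close> is 1, so the M-matrix
      condition concerns exactly the diagonal entries.\<close>
    have "M_matrix (mat 1 1 (\<lambda>_. M $$ (x,x)))"
      using assms singleton_principal_submatrix[OF M that] unfolding F0_matrix_def by auto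
    from M_matrix_order_1[OF _ this] show ?thesis by simp
  qed
  obtain C where C: "C \<in> principal_submatrices 2 M" "N0_matrix C"
    using assms unfolding F0_matrix_def by auto
  then obtain I where I: "I \<subseteq> {..<3}" "card I = 2" "C = submatrix M I I"
    using M unfolding principal_submatrices_def by auto
  define i j where "i = pick I 0" and "j = pick I 1"
  have ij: "i \<in> I" "j \<in> I" "i < j"
    using pick_in_set[of 0 I] pick_in_set[of 1 I] pick_mono[of 1 I 0] I(2)
    by (auto simp: i_def j_def)
  have Ceq: "C = mat 2 2 (\<lambda>(x, y). M $$ (pick I x, pick I y))"
    using submatrix_eq_pick[OF M I(1)] I by simp
  have minor: "M $$ (i,i) * M $$ (j,j) < M $$ (i,j) * M $$ (j,i)"
    using N0_matrix_order_2[OF _ C(2)] unfolding Ceq i_def j_def by simp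
  have lt: "i < 3" "j < 3" using ij I(1) by auto
  \<comment> \<open>The three indices 0, 1, 2 add up to 3, so this is the remaining one.\<close>
  define k where "k = 3 - i - j"
  have ijk: "{i, j, k} = {..<3}" "i \<noteq> j" "i \<noteq> k" "j \<noteq> k"
  proof -
    have "(i, j) \<in> {(0,1), (0,2), (1,2)}" using lt ij(3) by auto
    then show "{i, j, k} = {..<3}" "i \<noteq> j" "i \<noteq> k" "j \<noteq> k" by (auto simp: k_def)
  qed
  have k3: "k < 3" using ijk(1) by auto
  have jik: "{j, i, k} = {..<3}" "j \<noteq> i" "j \<noteq> k" "i \<noteq> k" using ijk by auto
  have kij: "{k, i, j} = {..<3}" "k \<noteq> i" "k \<noteq> j" "i \<noteq> j" using ijk by auto
  \<comment> \<open>Irreducibility enters through row and column \<open>k\<close>, the index outside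
    the negative minor.\<close>
  have "M $$ (i,j) < 0 \<and> M $$ (j,i) < 0 \<and> M $$ (k,k) = 0 \<and>
    (M $$ (j,j) = 0 \<and> M $$ (j,k) = 0 \<and> M $$ (k,j) = 0 \<or>
     M $$ (i,i) = 0 \<and> M $$ (i,k) = 0 \<and> M $$ (k,i) = 0)"
    by (rule singular_3_forces_star)
      (use det_zero_if_not_invertible[OF M assms(2)] det_3_symmetric[OF M ijk] minor
        row_not_zero_if_irreducible[OF M assms(3) kij] col_not_zero_if_irreducible[OF M assms(3) kij]
        lt k3 ijk in \<open>auto intro!: Z diag\<close>)
  \<comment> \<open>The first alternative is a star with centre \<open>i\<close>, the second one
    with centre \<open>j\<close>; the strictly negative pair at \<open>i, j\<close> serves in
    both.\<close>
  then show ?thesis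
    using moore_penrose_star[OF M ijk] moore_penrose_star[OF M jik] diag Z lt k3 ijk by auto
qed

end
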